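(* Let $G$ be a topological group and let $\alpha\colon G\to S$ be a $G$-compactification of $G$ such that the corresponding left $G$-invariant subalgebra $\mathcal{A}=\{F\circ\alpha: F\in C(S)\}$ of $\mathrm{RUC}(G)$ is also right $G$-invariant. Consider the following conditions: (1) $\mathcal{A}\subset\mathrm{UC}(G)$ (that is, $\alpha\colon G\to S$ is a Roelcke compactification). (2) The induced right action $S\times G\to S$, $(s,g)\mapsto s\alpha(g)$, is jointly continuous. (3) $\mathcal{A}\subset\mathrm{SUC}(G)$. Then: (a) always (1) $\Leftrightarrow$ (2) and (3) $\Rightarrow$ (1); (b) if, in addition, $S$ is a right topological semigroup and $\alpha\colon G\to S$ is a right topological semigroup compactification of $G$, then (1) $\Leftrightarrow$ (2) $\Leftrightarrow$ (3).
   Context: A $G$-space is a Tychonoff space with a continuous left action of $G$; a $G$-compactification of $G$ (acting on itself by left translations) is a continuous equivariant map $\alpha\colon G\to S$ with dense image into a compact $G$-space $S$. $\mathrm{RUC}(G)$ (resp. $\mathrm{LUC}(G)$) is the set of bounded continuous $f\colon G\to\mathbb{R}$ such that for every $\varepsilon>0$ there is a neighborhood $V$ of $e$ with $\sup_{g}|f(vg)-f(g)|<\varepsilon$ (resp. $\sup_g|f(gv)-f(g)|<\varepsilon$) for all $v\in V$; $\mathrm{UC}(G)=\mathrm{RUC}(G)\cap\mathrm{LUC}(G)$. $\mathcal{A}$ is left $G$-invariant, meaning $(fg)(x):=f(gx)$ lies in $\mathcal{A}$ for $f\in\mathcal A$, $g\in G$; it is right $G$-invariant if also $(gf)(x):=f(xg)$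 lies in $\mathcal{A}$ for all $f\in\mathcal{A}$, $g\in G$. Identifying $S$ with the Gelfand space of $\mathcal{A}$ (multiplicative functionals), the induced right action $S\times G\to S$, denoted $(s,g)\mapsto s\alpha(g)$, is the dual one: $(s\alpha(g))(f)=s(gf)$ for $f\in\mathcal{A}$; in particular it sends $(\alpha(x),g)$ to $\alpha(xg)$. A compact $G$-space $Y$, with its unique compatible uniformity $\mu_Y$, is SUC if for every $y_0\in Y$ and every $\varepsilon\in\mu_Y$ there is a neighborhood $U$ of $e$ such that $(guy_0,gy_0)\in\varepsilon$ for all $g\in G$, $u\in U$. $\mathrm{SUC}(G)$ is the set of bounded continuous $f\colon G\to\mathbb{R}$ of the form $f=F\circ\nu$ with $\nu\colon G\to Y$ a $G$-compactification, $Y$ SUC, and $F\colon Y\to\mathbb{R}$ continuous. A right topological semigroup is a compact semigroup $S$ such that $s\mapsto sp$ is continuous for every $p\in S$. A $G$-compactification $\alpha\colon G\to S$ is a right topological semigroup compactification if $S$ is a right topological semigroup and $\alpha$ is a homomorphism of semigroups.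
   Formalization: In (b) the formal definition of a right topological semigroup compactification also requires that each g in G acts on all of S as left multiplication by α(g); without this, (b) fails, e.g. for the Roelcke compactification of H_+[0,1] with an artificial multiplication. *)

theory Defs
  imports "HOL-Analysis.Analysis"
begin

text \<open>
  Groups are types of class \<open>topological_group_add\<close>. As usual for \<open>group_add\<close>, the notation is
  additive but the group is not assumed to be commutative: \<open>g + h\<close> is the product \<open>gh\<close>, \<open>0\<close> is
  the identity \<open>e\<close>. No separation axiom is imposed on the group itself.

  All other spaces are given by a topology in the sense of \<open>'a topology\<close>.
\<close>

section \<open>G-spaces and G-compactifications\<close>

definition G_space :: "'y topology \<Rightarrow> ('g::topological_group_add \<Rightarrow> 'y \<Rightarrow> 'y) \<Rightarrow> bool" where
  "G_space Y act \<longleftrightarrow>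
     completely_regular_space Y \<and> Hausdorff_space Y \<and>
     (\<forall>y\<in>topspace Y. act 0 y = y) \<and>
     (\<forall>g h. \<forall>y\<in>topspace Y. act (g + h) y = act g (act h y)) \<and>
     continuous_map (prod_topology euclidean Y) Y (\<lambda>(g, y). act g y)"

definition G_compactification ::
    "'y topology \<Rightarrow> ('g::topological_group_add \<Rightarrow> 'y \<Rightarrow> 'y) \<Rightarrow> ('g \<Rightarrow> 'y) \<Rightarrow> bool" where
  "G_compactification Y act \<nu> \<longleftrightarrow>
     G_space Y act \<and> compact_space Y \<and>
     continuous_map euclidean Y \<nu> \<and>
     (\<forall>g x. \<nu> (g + x) = act g (\<nu> x)) \<and>
     Y closure_of range \<nu> = topspace Y"

definition compactification_algebra :: "'s topology \<Rightarrow> ('g \<Rightarrow> 's) \<Rightarrow> ('g \<Rightarrow> real) set" where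
  "compactification_algebra S \<alpha> = {F \<circ> \<alpha> | F. continuous_map S euclideanreal F}"

text \<open>Right invariance of a set of functions; \<open>\<lambda>x. f (x + g)\<close> is the function \<open>gf\<close>.\<close>

definition right_G_invariant :: "('g::topological_group_add \<Rightarrow> real) set \<Rightarrow> bool" where
  "right_G_invariant \<A> \<longleftrightarrow> (\<forall>f\<in>\<A>. \<forall>g. (\<lambda>x. f (x + g)) \<in> \<A>)"

section \<open>Uniformly continuous functions\<close>

definition RUC :: "('g::topological_group_add \<Rightarrow> real) set" where
  "RUC = {f. bounded (range f) \<and> continuous_on UNIV f \<and>
     (\<forall>\<epsilon>>0. \<exists>V. open V \<and> 0 \<in> V \<and> (\<forall>v\<in>V. (SUP g. \<bar>f (v + g) - f g\<bar>) < \<epsilon>))}"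

definition LUC :: "('g::topological_group_add \<Rightarrow> real) set" where
  "LUC = {f. bounded (range f) \<and> continuous_on UNIV f \<and>
     (\<forall>\<epsilon>>0. \<exists>V. open V \<and> 0 \<in> V \<and> (\<forall>v\<in>V. (SUP g. \<bar>f (g + v) - f g\<bar>) < \<epsilon>))}"

definition UC :: "('g::topological_group_add \<Rightarrow> real) set" where
  "UC = RUC \<inter> LUC"

section \<open>The induced right action\<close>

text \<open>
  The point \<open>s\<close> of \<open>S\<close> as a multiplicative functional on the algebra of the compactification: its
  value at \<open>f = F \<circ> \<alpha>\<close> is \<open>F s\<close>. Here \<open>F\<close> is determined by \<open>f\<close> because \<open>\<alpha>\<close> has dense image.
\<close>

definition gelfand_eval :: "'s topology \<Rightarrow> ('g \<Rightarrow> 's) \<Rightarrow> 's \<Rightarrow> ('g \<Rightarrow> real) \<Rightarrow> real" where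
  "gelfand_eval S \<alpha> s f = (THE c. \<exists>F. continuous_map S euclideanreal F \<and> f = F \<circ> \<alpha> \<and> F s = c)"

definition induced_right_action ::
    "'s topology \<Rightarrow> ('g::topological_group_add \<Rightarrow> 's) \<Rightarrow> 's \<Rightarrow> 'g \<Rightarrow> 's" where
  "induced_right_action S \<alpha> s g =
     (THE t. t \<in> topspace S \<and>
        (\<forall>f\<in>compactification_algebra S \<alpha>.
           gelfand_eval S \<alpha> t f = gelfand_eval S \<alpha> s (\<lambda>x. f (x + g))))"

section \<open>Strongly uniformly continuous functions\<close>

text \<open>
  The axioms of the classes \<open>uniform_space\<close> and \<open>open_uniformity\<close>, relative to the carrier of the
  topology \<open>Y\<close>: \<open>\<mu>\<close> is a uniformity on \<open>topspace Y\<close> that induces \<open>Y\<close>. The entourages are the sets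
  \<open>{p. E p}\<close> with \<open>eventually E \<mu>\<close>, cut down to \<open>topspace Y \<times> topspace Y\<close>.
\<close>

definition compatible_uniformity :: "'y topology \<Rightarrow> ('y \<times> 'y) filter \<Rightarrow> bool" where
  "compatible_uniformity Y \<mu> \<longleftrightarrow>
     \<mu> \<le> principal (topspace Y \<times> topspace Y) \<and>
     (\<forall>E. eventually E \<mu> \<longrightarrow> (\<forall>y\<in>topspace Y. E (y, y))) \<and>
     (\<forall>E. eventually E \<mu> \<longrightarrow> eventually (\<lambda>(x, y). E (y, x)) \<mu>) \<and>
     (\<forall>E. eventually E \<mu> \<longrightarrow>
        (\<exists>D. eventually D \<mu> \<and> (\<forall>x y z. D (x, y) \<longrightarrow> D (y, z) \<longrightarrow> E (x, z)))) \<and>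
     (\<forall>U. openin Y U \<longleftrightarrow>
        U \<subseteq> topspace Y \<and> (\<forall>x\<in>U. eventually (\<lambda>(x', y). x' = x \<longrightarrow> y \<in> U) \<mu>))"

definition the_uniformity :: "'y topology \<Rightarrow> ('y \<times> 'y) filter" where
  "the_uniformity Y = (THE \<mu>. compatible_uniformity Y \<mu>)"

definition SUC_space ::
    "'y topology \<Rightarrow> ('g::topological_group_add \<Rightarrow> 'y \<Rightarrow> 'y) \<Rightarrow> bool" where
  "SUC_space Y act \<longleftrightarrow>
     G_space Y act \<and> compact_space Y \<and>
     (\<forall>y\<^sub>0\<in>topspace Y. \<forall>E. eventually E (the_uniformity Y) \<longrightarrow>
        (\<exists>U. open U \<and> 0 \<in> U \<and> (\<forall>g. \<forall>u\<in>U. E (act (g + u) y\<^sub>0, act g y\<^sub>0))))"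

text \<open>
  HOL cannot quantify over all types, so the carrier of \<open>Y\<close> is taken inside the type
  \<open>'g set set\<close>. This is no restriction: by \<open>SUC_functionsI\<close> below, any other type gives the same
  functions, because a compact Hausdorff space with a dense image of \<open>G\<close> embeds into the double
  power set of \<open>G\<close>.
\<close>

definition SUC_functions :: "('g::topological_group_add \<Rightarrow> real) set" where
  "SUC_functions = {f. bounded (range f) \<and> continuous_on UNIV f \<and>
     (\<exists>(Y :: 'g set set topology) act \<nu> F.
        G_compactification Y act \<nu> \<and> SUC_space Y act \<and>
        continuous_map Y euclideanreal F \<and> f = F \<circ> \<nu>)}"

section \<open>Right topological semigroup compactifications\<close>

definition right_topological_semigroup :: "'s topology \<Rightarrow> ('s \<Rightarrow> 's \<Rightarrow> 's) \<Rightarrow> bool" where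
  "right_topological_semigroup S mul \<longleftrightarrow>
     compact_space S \<and>
     (\<forall>s\<in>topspace S. \<forall>t\<in>topspace S. mul s t \<in> topspace S) \<and>
     (\<forall>r\<in>topspace S. \<forall>s\<in>topspace S. \<forall>t\<in>topspace S. mul (mul r s) t = mul r (mul s t)) \<and>
     (\<forall>p\<in>topspace S. continuous_map S S (\<lambda>s. mul s p))"

text \<open>
  The last clause says that the semigroup structure and the \<open>G\<close>-space structure of \<open>S\<close> belong
  together: \<open>g\<close> acts on \<open>S\<close> as left multiplication by \<open>\<alpha> g\<close>. On the dense set \<open>range \<alpha>\<close> this follows
  from the other clauses, but not on all of \<open>S\<close>: for injective \<open>\<alpha>\<close> with right invariant algebra, one may
  otherwise multiply by the induced right action, \<open>s * \<alpha> g = s \<alpha>(g)\<close>, and put \<open>s * p = p\<close> for all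
  \<open>p\<close> outside \<open>range \<alpha>\<close>.
\<close>

definition right_topological_semigroup_compactification ::
    "'s topology \<Rightarrow> ('g::topological_group_add \<Rightarrow> 's \<Rightarrow> 's) \<Rightarrow> ('g \<Rightarrow> 's) \<Rightarrow> ('s \<Rightarrow> 's \<Rightarrow> 's) \<Rightarrow> bool"
  where
  "right_topological_semigroup_compactification S act \<alpha> mul \<longleftrightarrow>
     G_compactification S act \<alpha> \<and>
     right_topological_semigroup S mul \<and>
     (\<forall>g h. \<alpha> (g + h) = mul (\<alpha> g) (\<alpha> h)) \<and>
     (\<forall>g. \<forall>s\<in>topspace S. act g s = mul (\<alpha> g) s)"

section \<open>The uniformity of a compact Hausdorff space\<close>

lemma open_square:
  assumes "openin (prod_topology Y Y) W" and "(x, x) \<in> W"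
  obtains U where "openin Y U" "x \<in> U" "U \<times> U \<subseteq> W"
proof -
  obtain A B where AB: "openin Y A" "openin Y B" "x \<in> A" "x \<in> B" "A \<times> B \<subseteq> W"
    using assms unfolding openin_prod_topology_alt by meson
  then have "openin Y (A \<inter> B)" "x \<in> A \<inter> B" "(A \<inter> B) \<times> (A \<inter> B) \<subseteq> W" by auto
  then show ?thesis by (rule that)
qed

lemma diagonal_half:
  assumes c: "compact_space Y" and h: "Hausdorff_space Y"
    and W: "openin (prod_topology Y Y) W" and dW: "\<And>y. y \<in> topspace Y \<Longrightarrow> (y, y) \<in> W"
  shows "\<exists>D. openin (prod_topology Y Y) D \<and> (\<forall>y\<in>topspace Y. (y, y) \<in> D) \<and>
           (\<forall>x y z. (x, y) \<in> D \<longrightarrow> (y, z) \<in> D \<longrightarrow> (x, z) \<in> W)"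
proof -
  have "\<exists>U V C. openin Y U \<and> openin Y V \<and> closedin Y C \<and> x \<in> V \<and> V \<subseteq> C \<and> C \<subseteq> U \<and> U \<times> U \<subseteq> W"
    if x: "x \<in> topspace Y" for x
  proof -
    obtain U where U: "openin Y U" "x \<in> U" "U \<times> U \<subseteq> W"
      using open_square[OF W dW[OF x]] .
    moreover have "regular_space Y"
      using c h compact_Hausdorff_or_regular_imp_normal_space compact_Hausdorff_imp_regular_space by blast
    ultimately obtain V C where "openin Y V" "closedin Y C" "x \<in> V" "V \<subseteq> C" "C \<subseteq> U"
      by (metis neighbourhood_base_of_closedin neighbourhood_base_of)
    then show ?thesis using U by blast
  qed
  then obtain U V C where UVC: "\<And>x. x \<in> topspace Y \<Longrightarrow> openin Y (U x) \<and> openin Y (V x) \<and> closedin Y (C x)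
      \<and> x \<in> V x \<and> V x \<subseteq> C x \<and> C x \<subseteq> U x \<and> U x \<times> U x \<subseteq> W"
    by metis
  have "compactin Y (topspace Y)" using c by (simp add: compact_space_def)
  then have "\<exists>\<F>. finite \<F> \<and> \<F> \<subseteq> V ` topspace Y \<and> topspace Y \<subseteq> \<Union>\<F>"
    by (rule compactinD) (use UVC in auto)
  then obtain I where I: "finite I" "I \<subseteq> topspace Y" "topspace Y \<subseteq> \<Union>(V ` I)"
    by (metis finite_subset_image)
  define D where "D = (topspace Y \<times> topspace Y) \<inter>
     (\<Inter>i\<in>I. U i \<times> U i \<union> (topspace Y - C i) \<times> (topspace Y - C i))"
  have "openin (prod_topology Y Y) D"
  proof (cases "I = {}")
    case True
    then show ?thesis unfolding D_def by (simp add: openin_prod_Times_iff)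
  next
    case False
    have "openin (prod_topology Y Y) (U i \<times> U i \<union> (topspace Y - C i) \<times> (topspace Y - C i))" if "i \<in> I" for i
    proof -
      have "openin Y (U i)" "openin Y (topspace Y - C i)"
        using that I UVC by (auto simp: closedin_def)
      then show ?thesis by (intro openin_Un) (auto simp: openin_prod_Times_iff)
    qed
    then show ?thesis unfolding D_def
      using I False by (intro openin_Int openin_INT2) (auto simp: openin_prod_Times_iff)
  qed
  moreover have "\<forall>y\<in>topspace Y. (y, y) \<in> D" unfolding D_def using I UVC by auto
  moreover have "(x, z) \<in> W" if xy: "(x, y) \<in> D" and yz: "(y, z) \<in> D" for x y z
  proof -
    have "y \<in> topspace Y" using xy by (auto simp: D_def)
    then obtain i where i: "i \<in> I" "y \<in> V i" using I by auto
    then have "y \<in> C i" "i \<in> topspace Y" using UVC I by auto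
    then have "x \<in> U i" "z \<in> U i" using xy yz i by (auto simp: D_def)
    then show ?thesis using UVC \<open>i \<in> topspace Y\<close> by blast
  qed
  ultimately show ?thesis by blast
qed

definition diagonal_filter :: "'y topology \<Rightarrow> ('y \<times> 'y) filter" where
  "diagonal_filter Y =
     (INF W\<in>{W. openin (prod_topology Y Y) W \<and> (\<forall>y\<in>topspace Y. (y, y) \<in> W)}. principal W)"

lemma eventually_diagonal_filter:
  "eventually E (diagonal_filter Y) \<longleftrightarrow>
     (\<exists>W. openin (prod_topology Y Y) W \<and> (\<forall>y\<in>topspace Y. (y, y) \<in> W) \<and> (\<forall>p\<in>W. E p))"
proof -
  let ?B = "{W. openin (prod_topology Y Y) W \<and> (\<forall>y\<in>topspace Y. (y, y) \<in> W)}"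
  have "topspace Y \<times> topspace Y \<in> ?B" by (simp add: openin_prod_Times_iff)
  then have "?B \<noteq> {}" by blast
  then have "eventually E (diagonal_filter Y) \<longleftrightarrow> (\<exists>W\<in>?B. eventually E (principal W))"
    unfolding diagonal_filter_def
  proof (rule eventually_INF_base)
    fix A B assume "A \<in> ?B" "B \<in> ?B"
    then have "A \<inter> B \<in> ?B" by auto
    then show "\<exists>x\<in>?B. principal x \<le> inf (principal A) (principal B)" by (intro bexI[of _ "A \<inter> B"]) auto
  qed
  then show ?thesis by (auto simp: eventually_principal)
qed

lemma compatible_diagonal_filter:
  assumes c: "compact_space Y" and h: "Hausdorff_space Y"
  shows "compatible_uniformity Y (diagonal_filter Y)"
proof -
  have "eventually (\<lambda>p. p \<in> topspace Y \<times> topspace Y) (diagonal_filter Y)"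
    unfolding eventually_diagonal_filter
    by (intro exI[of _ "topspace Y \<times> topspace Y"]) (simp add: openin_prod_Times_iff)
  then have 1: "diagonal_filter Y \<le> principal (topspace Y \<times> topspace Y)"
    by (simp add: le_principal)
  have 2: "E (y, y)" if "eventually E (diagonal_filter Y)" "y \<in> topspace Y" for E y
    using that by (auto simp: eventually_diagonal_filter)
  have 3: "eventually (\<lambda>(x, y). E (y, x)) (diagonal_filter Y)"
    if E: "eventually E (diagonal_filter Y)" for E
  proof -
    obtain W where W: "openin (prod_topology Y Y) W" "\<forall>y\<in>topspace Y. (y, y) \<in> W" "\<forall>p\<in>W. E p"
      using E by (auto simp: eventually_diagonal_filter)
    have "continuous_map (prod_topology Y Y) (prod_topology Y Y) (\<lambda>(x, y). (y, x))"
      by (simp add: case_prod_unfold continuous_map_pairedI continuous_map_fst continuous_map_snd)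
    from openin_continuous_map_preimage[OF this W(1)] W show ?thesis
      unfolding eventually_diagonal_filter
      by (intro exI[of _ "{p \<in> topspace (prod_topology Y Y). (case p of (x, y) \<Rightarrow> (y, x)) \<in> W}"]) auto
  qed
  have 4: "\<exists>D. eventually D (diagonal_filter Y) \<and> (\<forall>x y z. D (x, y) \<longrightarrow> D (y, z) \<longrightarrow> E (x, z))"
    if E: "eventually E (diagonal_filter Y)" for E
  proof -
    obtain W where W: "openin (prod_topology Y Y) W" "\<forall>y\<in>topspace Y. (y, y) \<in> W" "\<forall>p\<in>W. E p"
      using E by (auto simp: eventually_diagonal_filter)
    obtain D where D: "openin (prod_topology Y Y) D" "\<forall>y\<in>topspace Y. (y, y) \<in> D"
        "\<forall>x y z. (x, y) \<in> D \<longrightarrow> (y, z) \<in> D \<longrightarrow> (x, z) \<in> W"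
      using diagonal_half[OF c h W(1)] W(2) by blast
    show ?thesis
      using D W by (intro exI[of _ "\<lambda>p. p \<in> D"]) (auto simp: eventually_diagonal_filter)
  qed
  have 5: "openin Y U \<longleftrightarrow>
      U \<subseteq> topspace Y \<and> (\<forall>x\<in>U. eventually (\<lambda>(x', y). x' = x \<longrightarrow> y \<in> U) (diagonal_filter Y))" for U
  proof (intro iffI conjI ballI)
    assume U: "openin Y U"
    then show "U \<subseteq> topspace Y" by (rule openin_subset)
    fix x assume x: "x \<in> U"
    then have xY: "x \<in> topspace Y" using openin_subset[OF U] by blast
    have "closedin Y {x}" using h xY by (simp add: Hausdorff_imp_t1_space closedin_t1_singleton)
    then have "openin (prod_topology Y Y) ((topspace Y - {x}) \<times> topspace Y \<union> topspace Y \<times> U)"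
      using U by (intro openin_Un) (auto simp: openin_prod_Times_iff)
    then show "eventually (\<lambda>(x', y). x' = x \<longrightarrow> y \<in> U) (diagonal_filter Y)"
      using x unfolding eventually_diagonal_filter
      by (intro exI[of _ "(topspace Y - {x}) \<times> topspace Y \<union> topspace Y \<times> U"]) auto
  next
    assume U: "U \<subseteq> topspace Y \<and> (\<forall>x\<in>U. eventually (\<lambda>(x', y). x' = x \<longrightarrow> y \<in> U) (diagonal_filter Y))"
    show "openin Y U"
    proof (subst openin_subopen, intro ballI)
      fix x assume x: "x \<in> U"
      then obtain W where W: "openin (prod_topology Y Y) W" "\<forall>y\<in>topspace Y. (y, y) \<in> W"
          "\<forall>p\<in>W. case p of (x', y) \<Rightarrow> x' = x \<longrightarrow> y \<in> U"
        using U unfolding eventually_diagonal_filter by meson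
      have "(x, x) \<in> W" using W x U by auto
      then obtain B where B: "openin Y B" "x \<in> B" "B \<times> B \<subseteq> W" using open_square[OF W(1)] by blast
      have "B \<subseteq> U"
      proof
        fix y assume "y \<in> B"
        then have "(x, y) \<in> W" using B by auto
        then show "y \<in> U" using W(3) by auto
      qed
      then show "\<exists>T. openin Y T \<and> x \<in> T \<and> T \<subseteq> U" using B by blast
    qed
  qed
  show ?thesis unfolding compatible_uniformity_def using 1 2 3 4 5 by (intro conjI allI impI ballI) assumption+
qed

lemma compatible_uniformityD:
  assumes \<mu>: "compatible_uniformity Y \<mu>"
  shows "eventually (\<lambda>p. p \<in> topspace Y \<times> topspace Y) \<mu>"
    and "eventually E \<mu> \<Longrightarrow> y \<in> topspace Y \<Longrightarrow> E (y, y)"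
    and "eventually E \<mu> \<Longrightarrow> eventually (\<lambda>(x, y). E (y, x)) \<mu>"
    and "eventually E \<mu> \<Longrightarrow> \<exists>D. eventually D \<mu> \<and> (\<forall>x y z. D (x, y) \<longrightarrow> D (y, z) \<longrightarrow> E (x, z))"
    and "openin Y U \<longleftrightarrow> U \<subseteq> topspace Y \<and> (\<forall>x\<in>U. eventually (\<lambda>(x', y). x' = x \<longrightarrow> y \<in> U) \<mu>)"
proof -
  note c = \<mu>[unfolded compatible_uniformity_def le_principal]
  show "eventually (\<lambda>p. p \<in> topspace Y \<times> topspace Y) \<mu>"
    using c by (rule conjunct1)
  show "eventually E \<mu> \<Longrightarrow> y \<in> topspace Y \<Longrightarrow> E (y, y)"
    using c[THEN conjunct2, THEN conjunct1] by blast
  show "eventually E \<mu> \<Longrightarrow> eventually (\<lambda>(x, y). E (y, x)) \<mu>"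
    using c[THEN conjunct2, THEN conjunct2, THEN conjunct1] by simp
  show "eventually E \<mu> \<Longrightarrow> \<exists>D. eventually D \<mu> \<and> (\<forall>x y z. D (x, y) \<longrightarrow> D (y, z) \<longrightarrow> E (x, z))"
    using c[THEN conjunct2, THEN conjunct2, THEN conjunct2, THEN conjunct1] by simp
  show "openin Y U \<longleftrightarrow> U \<subseteq> topspace Y \<and> (\<forall>x\<in>U. eventually (\<lambda>(x', y). x' = x \<longrightarrow> y \<in> U) \<mu>)"
    by (rule c[THEN conjunct2, THEN conjunct2, THEN conjunct2, THEN conjunct2, THEN spec])
qed

lemma compatible_uniformity_nhd:
  assumes \<mu>: "compatible_uniformity Y \<mu>" and D: "eventually D \<mu>" and x: "x \<in> topspace Y"
  shows "\<exists>V. openin Y V \<and> x \<in> V \<and> (\<forall>y\<in>V. D (x, y))"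
proof -
  note car = compatible_uniformityD(1)[OF \<mu>] and refl = compatible_uniformityD(2)[OF \<mu>]
    and trans = compatible_uniformityD(4)[OF \<mu>] and op = compatible_uniformityD(5)[OF \<mu>]
  define V where "V = {y \<in> topspace Y. \<exists>D'. eventually D' \<mu> \<and> (\<forall>z. D' (y, z) \<longrightarrow> D (x, z))}"
  have "eventually (\<lambda>(y', z). y' = y \<longrightarrow> z \<in> V) \<mu>" if y: "y \<in> V" for y
  proof -
    obtain D' where D': "eventually D' \<mu>" "\<And>z. D' (y, z) \<Longrightarrow> D (x, z)" using y by (auto simp: V_def)
    obtain D2 where D2: "eventually D2 \<mu>" "\<And>a b c. D2 (a, b) \<Longrightarrow> D2 (b, c) \<Longrightarrow> D' (a, c)"
      using trans[OF D'(1)] by blast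
    show ?thesis
      using car D2(1)
    proof eventually_elim
      case (elim p)
      then show ?case using D2 D' by (cases p) (auto simp: V_def)
    qed
  qed
  then have "openin Y V" unfolding op by (auto simp: V_def)
  moreover have "x \<in> V" using D x by (auto simp: V_def)
  moreover have "D (x, y)" if "y \<in> V" for y
    using that refl by (auto simp: V_def)
  ultimately show ?thesis by blast
qed

lemma compatible_uniformity_unique:
  assumes c: "compact_space Y" and \<mu>: "compatible_uniformity Y \<mu>"
  shows "\<mu> = diagonal_filter Y"
proof (rule antisym)
  note car = compatible_uniformityD(1)[OF \<mu>] and refl = compatible_uniformityD(2)[OF \<mu>]
    and sym = compatible_uniformityD(3)[OF \<mu>] and trans = compatible_uniformityD(4)[OF \<mu>]
    and op = compatible_uniformityD(5)[OF \<mu>]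
  show "\<mu> \<le> diagonal_filter Y"
  proof (rule filter_leI)
    fix E assume "eventually E (diagonal_filter Y)"
    then obtain W where W: "openin (prod_topology Y Y) W" "\<forall>y\<in>topspace Y. (y, y) \<in> W" "\<forall>p\<in>W. E p"
      by (auto simp: eventually_diagonal_filter)
    have "\<exists>D V U. eventually D \<mu> \<and> openin Y V \<and> x \<in> V \<and> (\<forall>y\<in>V. D (x, y)) \<and>
            (\<forall>y z. D (x, y) \<longrightarrow> D (y, z) \<longrightarrow> z \<in> U) \<and> U \<times> U \<subseteq> W" (is "\<exists>D V U. ?P x D V U") if x: "x \<in> topspace Y" for x
    proof -
      have "(x, x) \<in> W" using W x by auto
      then obtain U where U: "openin Y U" "x \<in> U" "U \<times> U \<subseteq> W" using open_square[OF W(1)] by blast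
      then have "eventually (\<lambda>(x', y). x' = x \<longrightarrow> y \<in> U) \<mu>"
        using op[of U] by blast
      from trans[OF this] obtain D where D: "eventually D \<mu>"
        "\<forall>a y z. D (a, y) \<longrightarrow> D (y, z) \<longrightarrow> a = x \<longrightarrow> z \<in> U" by auto
      obtain V where "openin Y V" "x \<in> V" "\<forall>y\<in>V. D (x, y)"
        using compatible_uniformity_nhd[OF \<mu> D(1) x] by blast
      moreover have "\<forall>y z. D (x, y) \<longrightarrow> D (y, z) \<longrightarrow> z \<in> U" using D(2) by simp
      ultimately show ?thesis using D(1) U(3) by metis
    qed
    then have "\<forall>x\<in>topspace Y. \<exists>D V U. ?P x D V U" by blast
    from bchoice[OF this] obtain D where "\<forall>x\<in>topspace Y. \<exists>V U. ?P x (D x) V U" by blast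
    from bchoice[OF this] obtain V where "\<forall>x\<in>topspace Y. \<exists>U. ?P x (D x) (V x) U" by blast
    from bchoice[OF this] obtain U where DVU0: "\<forall>x\<in>topspace Y. ?P x (D x) (V x) (U x)" by blast
    have DVU: "\<And>x. x \<in> topspace Y \<Longrightarrow> eventually (D x) \<mu> \<and> openin Y (V x) \<and> x \<in> V x \<and>
        (\<forall>y\<in>V x. D x (x, y)) \<and> (\<forall>y z. D x (x, y) \<longrightarrow> D x (y, z) \<longrightarrow> z \<in> U x) \<and> U x \<times> U x \<subseteq> W"
      using DVU0 by (rule bspec)
    have "compactin Y (topspace Y)" using c by (simp add: compact_space_def)
    then have "\<exists>\<F>. finite \<F> \<and> \<F> \<subseteq> V ` topspace Y \<and> topspace Y \<subseteq> \<Union>\<F>"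
    proof (rule compactinD)
      fix U assume "U \<in> V ` topspace Y"
      then show "openin Y U" using DVU by (elim imageE) simp
    next
      show "topspace Y \<subseteq> \<Union>(V ` topspace Y)" using DVU by blast
    qed
    then obtain I where I: "finite I" "I \<subseteq> topspace Y" "topspace Y \<subseteq> \<Union>(V ` I)"
      by (metis finite_subset_image)
    have "eventually (\<lambda>p. \<forall>i\<in>I. D i p) \<mu>"
    proof (rule eventually_ball_finite[OF I(1)], intro ballI)
      fix i assume "i \<in> I"
      then have "i \<in> topspace Y" using I(2) by blast
      from DVU[OF this] show "eventually (D i) \<mu>" by simp
    qed
    with car show "eventually E \<mu>"
    proof eventually_elim
      case (elim p)
      obtain a b where p: "p = (a, b)" by force
      obtain i where i: "i \<in> I" "a \<in> V i" using elim I p by auto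
      then have iY: "i \<in> topspace Y" using I by auto
      have Di: "eventually (D i) \<mu>" "\<forall>y\<in>V i. D i (i, y)" "U i \<times> U i \<subseteq> W"
        and DU: "\<And>y z. D i (i, y) \<Longrightarrow> D i (y, z) \<Longrightarrow> z \<in> U i"
        using DVU[OF iY] by simp_all
      have "D i (i, a)" using Di(2) i(2) by blast
      moreover have "D i (a, b)" using elim(2) i(1) p by simp
      moreover have "D i (a, a)" using refl[OF Di(1)] elim(1) p by simp
      ultimately have "a \<in> U i" "b \<in> U i" using DU by simp_all
      then have "p \<in> W" using Di(3) p by blast
      then show ?case using W(3) by simp
    qed
  qed
  show "diagonal_filter Y \<le> \<mu>"
  proof (rule filter_leI)
    fix E assume E: "eventually E \<mu>"
    obtain D where D: "eventually D \<mu>" "\<And>x y z. D (x, y) \<Longrightarrow> D (y, z) \<Longrightarrow> E (x, z)"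
      using trans[OF E] by blast
    have ev: "eventually (\<lambda>p. D p \<and> (case p of (x, y) \<Rightarrow> D (y, x))) \<mu>"
      using D(1) sym[OF D(1)] by (rule eventually_conj)
    have "\<forall>x\<in>topspace Y. \<exists>V. openin Y V \<and> x \<in> V \<and> (\<forall>y\<in>V. D (x, y) \<and> D (y, x))"
    proof
      fix x assume "x \<in> topspace Y"
      from compatible_uniformity_nhd[OF \<mu> ev this]
      show "\<exists>V. openin Y V \<and> x \<in> V \<and> (\<forall>y\<in>V. D (x, y) \<and> D (y, x))" by simp
    qed
    from bchoice[OF this] obtain V where V0: "\<forall>x\<in>topspace Y.
        openin Y (V x) \<and> x \<in> V x \<and> (\<forall>y\<in>V x. D (x, y) \<and> D (y, x))" by blast
    have V: "\<And>x. x \<in> topspace Y \<Longrightarrow>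
        openin Y (V x) \<and> x \<in> V x \<and> (\<forall>y\<in>V x. D (x, y) \<and> D (y, x))"
      using V0 by (rule bspec)
    have "openin (prod_topology Y Y) (\<Union>x\<in>topspace Y. V x \<times> V x)"
      using V by (intro openin_Union) (auto simp: openin_prod_Times_iff)
    then show "eventually E (diagonal_filter Y)"
      unfolding eventually_diagonal_filter
    proof (intro exI conjI ballI)
      fix y assume "y \<in> topspace Y"
      then show "(y, y) \<in> (\<Union>x\<in>topspace Y. V x \<times> V x)" using V by auto
    next
      fix p assume "p \<in> (\<Union>x\<in>topspace Y. V x \<times> V x)"
      then obtain x a b where x: "x \<in> topspace Y" "a \<in> V x" "b \<in> V x" and p: "p = (a, b)" by blast
      have "D (a, x)" "D (x, b)" using V[OF x(1)] x by simp_all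
      then show "E p" unfolding p by (rule D(2))
    qed
  qed
qed

lemma eventually_the_uniformity:
  assumes "compact_space Y" and "Hausdorff_space Y"
  shows "eventually E (the_uniformity Y) \<longleftrightarrow>
     (\<exists>W. openin (prod_topology Y Y) W \<and> (\<forall>y\<in>topspace Y. (y, y) \<in> W) \<and> (\<forall>p\<in>W. E p))"
proof -
  have "the_uniformity Y = diagonal_filter Y"
    unfolding the_uniformity_def
    using assms compatible_diagonal_filter compatible_uniformity_unique by (intro the_equality) auto
  then show ?thesis by (simp add: eventually_diagonal_filter)
qed

section \<open>Independence of the carrier type\<close>

lemma G_compactification_transport:
  assumes hm: "homeomorphic_maps Y Z j k" and Y: "G_compactification Y act \<nu>"
  shows "G_compactification Z (\<lambda>g z. j (act g (k z))) (j \<circ> \<nu>)"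
proof -
  have j: "continuous_map Y Z j" and k: "continuous_map Z Y k"
    and kj: "\<And>y. y \<in> topspace Y \<Longrightarrow> k (j y) = y" and jk: "\<And>z. z \<in> topspace Z \<Longrightarrow> j (k z) = z"
    using hm by (auto simp: homeomorphic_maps_def)
  have hs: "Y homeomorphic_space Z" using hm homeomorphic_space_def by blast
  have act: "continuous_map (prod_topology euclidean Y) Y (\<lambda>(g, y). act g y)"
    and a0: "\<And>y. y \<in> topspace Y \<Longrightarrow> act 0 y = y"
    and aa: "\<And>g h y. y \<in> topspace Y \<Longrightarrow> act (g + h) y = act g (act h y)"
    and cr: "completely_regular_space Y" and H: "Hausdorff_space Y" and c: "compact_space Y"
    and \<nu>: "continuous_map euclidean Y \<nu>" and eq: "\<And>g x. \<nu> (g + x) = act g (\<nu> x)"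
    and d: "Y closure_of range \<nu> = topspace Y"
    using Y by (auto simp: G_compactification_def G_space_def)
  have aY: "act g y \<in> topspace Y" if "y \<in> topspace Y" for g y
    using continuous_map_image_subset_topspace[OF act] that by (auto simp: image_subset_iff)
  have kY: "k z \<in> topspace Y" if "z \<in> topspace Z" for z
    using k that continuous_map_image_subset_topspace by blast
  have \<nu>Y: "\<nu> x \<in> topspace Y" for x
    using continuous_map_image_subset_topspace[OF \<nu>] by auto
  have "continuous_map (prod_topology euclidean Z) (prod_topology euclidean Y) (\<lambda>p. (fst p, k (snd p)))"
    by (intro continuous_map_pairedI continuous_map_fst
        continuous_map_compose[OF continuous_map_snd k, unfolded comp_def])
  from continuous_map_compose[OF continuous_map_compose[OF this act] j]
  have "continuous_map (prod_topology euclidean Z) Z (\<lambda>(g, z). j (act g (k z)))"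
    by (simp add: comp_def case_prod_unfold)
  moreover have "completely_regular_space Z" "Hausdorff_space Z" "compact_space Z"
    using cr H c hs homeomorphic_completely_regular_space homeomorphic_Hausdorff_space
      homeomorphic_compact_space by blast+
  moreover have "Z closure_of range (j \<circ> \<nu>) = topspace Z"
  proof -
    have hj: "homeomorphic_map Y Z j" using hm homeomorphic_map_maps by blast
    have "Z closure_of (j ` range \<nu>) = j ` (Y closure_of range \<nu>)"
      by (rule homeomorphic_map_closure_of[OF hj]) (use \<nu>Y in auto)
    then show ?thesis using d homeomorphic_imp_surjective_map[OF hj] by (simp add: image_comp)
  qed
  moreover have "continuous_map euclidean Z (j \<circ> \<nu>)"
    using \<nu> j by (rule continuous_map_compose)
  ultimately show ?thesis
    unfolding G_compactification_def G_space_def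
    using jk kY a0 aa kj aY eq \<nu>Y by simp
qed

lemma SUC_space_transport:
  assumes hm: "homeomorphic_maps Y Z j k" and Y: "G_compactification Y act \<nu>"
    and S: "SUC_space Y act"
  shows "SUC_space Z (\<lambda>g z. j (act g (k z)))"
proof -
  have Z: "G_space Z (\<lambda>g z. j (act g (k z)))" "compact_space Z" "Hausdorff_space Z"
    using G_compactification_transport[OF hm Y] by (simp_all add: G_compactification_def G_space_def)
  have Y': "compact_space Y" "Hausdorff_space Y"
    and act: "continuous_map (prod_topology euclidean Y) Y (\<lambda>(g, y). act g y)"
    using Y by (simp_all add: G_compactification_def G_space_def)
  have j: "continuous_map Y Z j" and k: "continuous_map Z Y k"
    and kj: "\<And>y. y \<in> topspace Y \<Longrightarrow> k (j y) = y"
    using hm by (auto simp: homeomorphic_maps_def)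
  have aY: "act g y \<in> topspace Y" if "y \<in> topspace Y" for g y
    using continuous_map_image_subset_topspace[OF act] that by (auto simp: image_subset_iff)
  have jY: "j y \<in> topspace Z" if "y \<in> topspace Y" for y
    using j that continuous_map_image_subset_topspace by blast
  have kY: "k z \<in> topspace Y" if "z \<in> topspace Z" for z
    using k that continuous_map_image_subset_topspace by blast
  have "\<exists>U. open U \<and> 0 \<in> U \<and> (\<forall>g. \<forall>u\<in>U. E (j (act (g + u) (k z)), j (act g (k z))))"
    if z: "z \<in> topspace Z" and E: "eventually E (the_uniformity Z)" for z E
  proof -
    obtain W where W: "openin (prod_topology Z Z) W" "\<forall>y\<in>topspace Z. (y, y) \<in> W" "\<forall>p\<in>W. E p"
      using E unfolding eventually_the_uniformity[OF Z(2,3)] by blast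
    have "continuous_map (prod_topology Y Y) (prod_topology Z Z) (\<lambda>p. (j (fst p), j (snd p)))"
      by (intro continuous_map_pairedI continuous_map_compose[OF continuous_map_fst j, unfolded comp_def]
          continuous_map_compose[OF continuous_map_snd j, unfolded comp_def])
    from openin_continuous_map_preimage[OF this W(1)]
    have "openin (prod_topology Y Y) {p \<in> topspace (prod_topology Y Y). (j (fst p), j (snd p)) \<in> W}" .
    then have "eventually (\<lambda>p. E (j (fst p), j (snd p))) (the_uniformity Y)"
      unfolding eventually_the_uniformity[OF Y']
      using W jY by (intro exI[of _ "{p \<in> topspace (prod_topology Y Y). (j (fst p), j (snd p)) \<in> W}"]) auto
    then show ?thesis using S kY[OF z] unfolding SUC_space_def by fastforce
  qed
  then show ?thesis using Z unfolding SUC_space_def by blast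
qed

lemma dense_image_embeds:
  fixes \<nu> :: "'g \<Rightarrow> 'y"
  assumes H: "Hausdorff_space Y" and c: "compact_space Y"
    and \<nu>: "range \<nu> \<subseteq> topspace Y" and d: "Y closure_of range \<nu> = topspace Y"
  shows "inj_on (\<lambda>y. {A. y \<in> Y closure_of (\<nu> ` A)}) (topspace Y)"
proof (rule inj_onI, rule ccontr)
  fix y z assume y: "y \<in> topspace Y" and z: "z \<in> topspace Y"
    and eq: "{A. y \<in> Y closure_of (\<nu> ` A)} = {A. z \<in> Y closure_of (\<nu> ` A)}" and "y \<noteq> z"
  then obtain U V where UV: "openin Y U" "openin Y V" "y \<in> U" "z \<in> V" "disjnt U V"
    using H unfolding Hausdorff_space_def by meson
  let ?A = "\<nu> -` U"
  have "y \<in> Y closure_of (\<nu> ` ?A)"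
    unfolding in_closure_of
  proof (intro conjI allI impI)
    fix T assume T: "y \<in> T \<and> openin Y T"
    then have "openin Y (T \<inter> U)" "y \<in> T \<inter> U" using UV by auto
    moreover have "y \<in> Y closure_of range \<nu>" using d y by simp
    ultimately obtain x where "\<nu> x \<in> T \<inter> U" unfolding in_closure_of by blast
    then show "\<exists>w. w \<in> \<nu> ` ?A \<and> w \<in> T" by blast
  qed (rule y)
  moreover have "z \<notin> Y closure_of (\<nu> ` ?A)"
    using UV unfolding in_closure_of disjnt_iff by blast
  ultimately show False using eq by blast
qed

lemma SUC_functionsI:
  fixes Y :: "'y topology" and \<nu> :: "'g::topological_group_add \<Rightarrow> 'y"
  assumes Y: "G_compactification Y act \<nu>" and S: "SUC_space Y act"
    and F: "continuous_map Y euclideanreal F"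
  shows "F \<circ> \<nu> \<in> SUC_functions"
proof -
  have H: "Hausdorff_space Y" and c: "compact_space Y" and \<nu>: "continuous_map euclidean Y \<nu>"
    and d: "Y closure_of range \<nu> = topspace Y"
    using Y by (simp_all add: G_compactification_def G_space_def)
  have \<nu>Y: "range \<nu> \<subseteq> topspace Y"
    using continuous_map_image_subset_topspace[OF \<nu>] by simp
  define j where "j = (\<lambda>y. {A. y \<in> Y closure_of (\<nu> ` A)})"
  have inj: "inj_on j (topspace Y)"
    unfolding j_def by (rule dense_image_embeds[OF H c \<nu>Y d])
  define k where "k = inv_into (topspace Y) j"
  define Z where "Z = pullback_topology (j ` topspace Y) k Y"
  have kj: "k (j y) = y" if "y \<in> topspace Y" for y
    using inj that by (simp add: k_def)
  have tZ: "topspace Z = j ` topspace Y"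
    by (auto simp: Z_def topspace_pullback_topology kj)
  have hm: "homeomorphic_maps Y Z j k"
    unfolding homeomorphic_maps_def
  proof (intro conjI ballI)
    show "continuous_map Z Y k"
      unfolding Z_def
      using continuous_map_pullback[OF continuous_map_id, where A = "j ` topspace Y" and f = k] by simp
    show "continuous_map Y Z j"
      unfolding Z_def
    proof (rule continuous_map_pullback')
      show "continuous_map Y Y (k \<circ> j)"
        by (rule continuous_map_eq[OF continuous_map_id]) (simp add: kj)
    qed auto
  qed (auto simp: kj tZ)
  have "compactin euclideanreal (F ` topspace Y)"
    using c F unfolding compact_space_def by (rule image_compactin)
  then have "bounded (F ` topspace Y)" by (simp add: compact_imp_bounded)
  then have "bounded (range (F \<circ> \<nu>))"
    by (rule bounded_subset) (use \<nu>Y in auto)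
  moreover have "continuous_on UNIV (F \<circ> \<nu>)"
    using continuous_map_compose[OF \<nu> F] by simp
  moreover have "continuous_map Z euclideanreal (F \<circ> k)"
    using hm F by (auto simp: homeomorphic_maps_def intro: continuous_map_compose)
  moreover have "F \<circ> \<nu> = (F \<circ> k) \<circ> (j \<circ> \<nu>)"
  proof
    fix x
    have "\<nu> x \<in> topspace Y" using \<nu>Y by blast
    then show "(F \<circ> \<nu>) x = ((F \<circ> k) \<circ> (j \<circ> \<nu>)) x" by (simp add: kj)
  qed
  ultimately show ?thesis
    unfolding SUC_functions_def
    using G_compactification_transport[OF hm Y] SUC_space_transport[OF hm Y S] by blast
qed

section \<open>The induced right action is well defined\<close>

lemma gelfand_eval_eq:
  assumes d: "S closure_of range \<alpha> = topspace S" and s: "s \<in> topspace S"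
    and F: "continuous_map S euclideanreal F"
  shows "gelfand_eval S \<alpha> s (F \<circ> \<alpha>) = F s"
  unfolding gelfand_eval_def
proof (rule the_equality)
  show "\<exists>F'. continuous_map S euclideanreal F' \<and> F \<circ> \<alpha> = F' \<circ> \<alpha> \<and> F' s = F s"
    using F by blast
next
  fix c assume "\<exists>F'. continuous_map S euclideanreal F' \<and> F \<circ> \<alpha> = F' \<circ> \<alpha> \<and> F' s = c"
  then obtain F' where F': "continuous_map S euclideanreal F'" "F \<circ> \<alpha> = F' \<circ> \<alpha>" "F' s = c" by blast
  have "F s = F' s"
  proof (rule forall_in_closure_of_eq[OF _ _ F F'(1)])
    show "s \<in> S closure_of range \<alpha>" using d s by simp
    show "F x = F' x" if "x \<in> range \<alpha>" for x
      using that F'(2) by (auto simp: fun_eq_iff)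
  qed simp
  then show "c = F s" using F'(3) by simp
qed

lemma induced_right_action:
  assumes S: "G_compactification S act \<alpha>"
    and inv: "right_G_invariant (compactification_algebra S \<alpha>)"
    and s: "s \<in> topspace S"
  shows "induced_right_action S \<alpha> s g \<in> topspace S"
    and "f \<in> compactification_algebra S \<alpha> \<Longrightarrow>
      gelfand_eval S \<alpha> (induced_right_action S \<alpha> s g) f = gelfand_eval S \<alpha> s (\<lambda>x. f (x + g))"
proof -
  have cr: "completely_regular_space S" and H: "Hausdorff_space S" and c: "compact_space S"
    and \<alpha>: "continuous_map euclidean S \<alpha>" and d: "S closure_of range \<alpha> = topspace S"
    using S by (simp_all add: G_compactification_def G_space_def)
  have \<alpha>S: "\<alpha> x \<in> topspace S" for x
    using continuous_map_image_subset_topspace[OF \<alpha>] by auto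
  define C where "C = {F. continuous_map S euclideanreal F}"
  have "\<exists>F'. F' \<in> C \<and> (\<forall>x. F' (\<alpha> x) = F (\<alpha> (x + g)))" if "F \<in> C" for F
  proof -
    have "F \<circ> \<alpha> \<in> compactification_algebra S \<alpha>"
      using that unfolding C_def compactification_algebra_def by blast
    then have "(\<lambda>x. (F \<circ> \<alpha>) (x + g)) \<in> compactification_algebra S \<alpha>"
      using inv unfolding right_G_invariant_def by blast
    then obtain F' where "F' \<in> C" "(\<lambda>x. (F \<circ> \<alpha>) (x + g)) = F' \<circ> \<alpha>"
      unfolding C_def compactification_algebra_def by blast
    then show ?thesis by (intro exI[of _ F']) (simp add: fun_eq_iff)
  qed
  then obtain R where R: "\<And>F. F \<in> C \<Longrightarrow> R F \<in> C" "\<And>F x. F \<in> C \<Longrightarrow> R F (\<alpha> x) = F (\<alpha> (x + g))"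
    by metis
  have evR: "gelfand_eval S \<alpha> s (\<lambda>x. (F \<circ> \<alpha>) (x + g)) = R F s" if "F \<in> C" for F
  proof -
    have "(\<lambda>x. (F \<circ> \<alpha>) (x + g)) = R F \<circ> \<alpha>" using R(2)[OF that] by (simp add: fun_eq_iff)
    moreover have "continuous_map S euclideanreal (R F)" using R(1)[OF that] by (simp add: C_def)
    ultimately show ?thesis using gelfand_eval_eq[OF d s] by simp
  qed
  define K where "K = (\<lambda>(F, e::real). {t \<in> topspace S. F t \<in> {R F s - e..R F s + e}})"
  have "\<exists>t. t \<in> topspace S \<and> (\<forall>F\<in>C. F t = R F s)"
  proof -
    have "\<Inter>(K ` (C \<times> {0<..})) \<noteq> {}"
    proof -
      have cl: "closedin S B" if "B \<in> K ` (C \<times> {0<..})" for B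
      proof -
        obtain F e where "F \<in> C" "B = K (F, e)" using \<open>B \<in> K ` (C \<times> {0<..})\<close> by auto
        then have "continuous_map S euclideanreal F" by (simp add: C_def)
        then have "closedin S {t \<in> topspace S. F t \<in> {R F s - e..R F s + e}}"
          by (rule closedin_continuous_map_preimage) (simp flip: closed_closedin)
        then show ?thesis using \<open>B = K (F, e)\<close> by (simp add: K_def)
      qed
      have fip: "\<Inter>\<F> \<noteq> {}" if fin: "finite \<F>" and sub: "\<F> \<subseteq> K ` (C \<times> {0<..})" for \<F>
      proof -
        obtain I where I: "finite I" "I \<subseteq> C \<times> {0<..}" "\<F> = K ` I"
          using finite_subset_image[OF fin sub] by blast
        define U where "U = topspace S \<inter>
          (\<Inter>i\<in>I. {t \<in> topspace S. R (fst i) t \<in> {R (fst i) s - snd i<..<R (fst i) s + snd i}})"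
        have op: "openin S {t \<in> topspace S. R (fst i) t \<in> {R (fst i) s - snd i<..<R (fst i) s + snd i}}"
          if "i \<in> I" for i
        proof (rule openin_continuous_map_preimage)
          have "fst i \<in> C" using I(2) that by auto
          then show "continuous_map S euclideanreal (R (fst i))" using R(1) by (simp add: C_def)
        qed (simp flip: open_openin)
        have "openin S U"
        proof (cases "I = {}")
          case False
          then show ?thesis unfolding U_def using I(1) op by (intro openin_Int openin_INT2) auto
        qed (simp add: U_def)
        moreover have "s \<in> U" using s I(2) by (auto simp: U_def)
        moreover have "s \<in> S closure_of range \<alpha>" using s d by simp
        ultimately obtain x where x: "\<alpha> x \<in> U" unfolding in_closure_of by blast
        have "\<alpha> (x + g) \<in> K i" if i: "i \<in> I" for i
        proof -
          have "fst i \<in> C" using i I(2) by auto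
          moreover have "R (fst i) (\<alpha> x) \<in> {R (fst i) s - snd i<..<R (fst i) s + snd i}"
            using x i by (simp add: U_def)
          ultimately show ?thesis
            using \<alpha>S R(2)[of "fst i" x] by (simp add: K_def case_prod_unfold)
        qed
        then show ?thesis using I(3) by blast
      qed
      show ?thesis using c[unfolded compact_space_fip] cl fip by (metis (no_types, lifting))
    qed
    then obtain t where t: "\<And>F e. F \<in> C \<Longrightarrow> e > 0 \<Longrightarrow> t \<in> K (F, e)" by auto
    have "t \<in> topspace S"
      using t[of "\<lambda>_. 0" 1] by (simp add: K_def C_def)
    moreover have "F t = R F s" if F: "F \<in> C" for F
    proof (rule ccontr)
      assume ne: "F t \<noteq> R F s"
      have "t \<in> K (F, \<bar>F t - R F s\<bar> / 2)" using ne by (intro t[OF F]) simp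
      then show False using ne by (auto simp: K_def abs_if field_simps split: if_splits)
    qed
    ultimately show ?thesis by blast
  qed
  then obtain t where t: "t \<in> topspace S" "\<And>F. F \<in> C \<Longrightarrow> F t = R F s" by blast
  let ?P = "\<lambda>t. t \<in> topspace S \<and> (\<forall>f\<in>compactification_algebra S \<alpha>.
     gelfand_eval S \<alpha> t f = gelfand_eval S \<alpha> s (\<lambda>x. f (x + g)))"
  have P: "?P u \<longleftrightarrow> u \<in> topspace S \<and> (\<forall>F\<in>C. F u = R F s)" for u
  proof (cases "u \<in> topspace S")
    case True
    have "gelfand_eval S \<alpha> u (F \<circ> \<alpha>) = F u" if "F \<in> C" for F
      using gelfand_eval_eq[OF d True] that by (simp add: C_def)
    moreover have "compactification_algebra S \<alpha> = (\<lambda>F. F \<circ> \<alpha>) ` C"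
      by (auto simp: compactification_algebra_def C_def)
    ultimately show ?thesis using True evR by (simp del: comp_apply)
  qed simp
  have "u = t" if u: "?P u" for u
  proof (rule ccontr)
    assume "u \<noteq> t"
    have uS: "u \<in> topspace S" using u P by blast
    have "closedin S {t}" using t H by (simp add: Hausdorff_imp_t1_space closedin_t1_singleton)
    then obtain F where F: "continuous_map S (top_of_set {0..1}) F" "F u = (0::real)" "F ` {t} \<subseteq> {1}"
      using cr uS \<open>u \<noteq> t\<close> unfolding completely_regular_space_def by (metis DiffI singletonD)
    have "F \<in> C" using F(1) by (simp add: C_def continuous_map_in_subtopology)
    then have "F u = F t" using u P t(2) by simp
    then show False using F by simp
  qed
  moreover have "?P t" using P t by blast
  ultimately have "?P (induced_right_action S \<alpha> s g)"
    unfolding induced_right_action_def by (rule theI[of ?P, rotated])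
  then show "induced_right_action S \<alpha> s g \<in> topspace S"
    and "f \<in> compactification_algebra S \<alpha> \<Longrightarrow>
      gelfand_eval S \<alpha> (induced_right_action S \<alpha> s g) f = gelfand_eval S \<alpha> s (\<lambda>x. f (x + g))"
    by blast+
qed

end

theory Submission
  imports Defs
begin

text \<open>
  Write \<open>s \<alpha>(g)\<close> for the induced right action. Left uniform continuity of all \<open>F \<circ> \<alpha>\<close> says that
  \<open>\<alpha>(x) \<alpha>(g)\<close> depends on \<open>g\<close> uniformly in \<open>x\<close>, hence, by density, \<open>s \<alpha>(g)\<close> depends on \<open>g\<close>
  uniformly in \<open>s\<close>; together with continuity in \<open>s\<close> this is joint continuity. Conversely the tube
  lemma turns joint continuity into uniformity over the compact space \<open>S\<close>.
  A function \<open>F \<circ> \<nu>\<close> on an SUC compactification is left uniformly continuous by the SUC condition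
  at the single point \<open>\<nu> e\<close>, since \<open>\<nu>(gu) = gu \<nu>(e)\<close>. Finally, if \<open>S\<close> is a right topological
  semigroup, then \<open>(gu)p = (\<alpha>(g) \<alpha>(u)) p\<close> is the image of \<open>\<alpha>(g) \<alpha>(u)\<close> under the
  continuous map \<open>s \<mapsto> s p\<close>, so that joint continuity of the right action makes \<open>S\<close> itself SUC.
\<close>

section \<open>Uniformity from compactness and testing continuity by real functions\<close>

text \<open>The preimage of \<open>W\<close> is open and contains the compact slice
  \<open>topspace X \<times> {0}\<close>, so the tube lemma applies. Every neighborhood of the
  identity below that is found by compactness comes from here.\<close>

lemma uniform_near_zero:
  fixes h :: "'a \<times> 'b::{topological_space, zero} \<Rightarrow> 'c"
  assumes "compact_space X" and h: "continuous_map (prod_topology X euclidean) Z h"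
    and W: "openin Z W" and 0: "\<And>s. s \<in> topspace X \<Longrightarrow> h (s, 0) \<in> W"
  obtains V where "open V" "0 \<in> V" "\<And>s v. s \<in> topspace X \<Longrightarrow> v \<in> V \<Longrightarrow> h (s, v) \<in> W"
proof -
  let ?P = "{p \<in> topspace (prod_topology X euclidean). h p \<in> W}"
  have "openin (prod_topology X euclidean) ?P"
    using h W by (rule openin_continuous_map_preimage)
  moreover have "topspace X \<times> {0} \<subseteq> ?P" using 0 by auto
  moreover have "compactin X (topspace X)" using assms(1) by (simp add: compact_space_def)
  ultimately obtain U V where "topspace X \<subseteq> U" "openin euclidean V" "0 \<in> V" "U \<times> V \<subseteq> ?P"
    using tube_lemma_left[of X euclidean ?P "topspace X" 0] by auto
  then show thesis by (intro that[of V]) auto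
qed

text \<open>In a completely regular space the sets where some real continuous \<open>F\<close> is
  \<open>< 1\<close> form a base. The right action is known only through its composites with such
  \<open>F\<close>, so its continuity has to be tested this way.\<close>

lemma continuous_map_into_completely_regular:
  assumes Y: "completely_regular_space Y" and h: "h ` topspace X \<subseteq> topspace Y"
    and F: "\<And>F. continuous_map Y euclideanreal F \<Longrightarrow> continuous_map X euclideanreal (F \<circ> h)"
  shows "continuous_map X Y h"
  unfolding continuous_map
proof (intro conjI allI impI h)
  fix U assume U: "openin Y U"
  show "openin X {x \<in> topspace X. h x \<in> U}"
  proof (subst openin_subopen, intro ballI)
    fix x assume "x \<in> {x \<in> topspace X. h x \<in> U}"
    then have x: "x \<in> topspace X" "h x \<in> U" by auto
    then obtain F where c: "continuous_map Y euclideanreal F" "F (h x) = 0" "F ` (topspace Y - U) \<subseteq> {1}"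
      using Y U unfolding completely_regular_space_alt' by meson
    have "openin X {y \<in> topspace X. (F \<circ> h) y \<in> {..<1}}"
      using F[OF c(1)] by (rule openin_continuous_map_preimage) simp
    moreover have "{y \<in> topspace X. (F \<circ> h) y \<in> {..<1}} \<subseteq> {x \<in> topspace X. h x \<in> U}"
      using c(3) h by force
    ultimately show "\<exists>T. openin X T \<and> x \<in> T \<and> T \<subseteq> {x \<in> topspace X. h x \<in> U}"
      using x c(2) by (intro exI[of _ "{y \<in> topspace X. (F \<circ> h) y \<in> {..<1}}"]) auto
  qed
qed

section \<open>Uniform continuity without suprema\<close>

text \<open>Boundedness of \<open>f\<close> bounds the differences above, so that each of them lies
  below the \<open>SUP\<close>. The parameter \<open>t\<close> serves left and right translations at
  once.\<close>

lemma SUP_diff_less_iff: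
  fixes f :: "'g::{topological_space, zero} \<Rightarrow> real" and t :: "'g \<Rightarrow> 'g \<Rightarrow> 'g"
  assumes f: "bounded (range f)"
  shows "(\<forall>\<epsilon>>0. \<exists>V. open V \<and> 0 \<in> V \<and> (\<forall>v\<in>V. (SUP g. \<bar>f (t v g) - f g\<bar>) < \<epsilon>)) \<longleftrightarrow>
    (\<forall>\<epsilon>>0. \<exists>V. open V \<and> 0 \<in> V \<and> (\<forall>v\<in>V. \<forall>g. \<bar>f (t v g) - f g\<bar> < \<epsilon>))"
    (is "?L \<longleftrightarrow> ?R")
proof
  obtain B where B: "\<And>x. \<bar>f x\<bar> \<le> B" using f by (auto simp: bounded_iff)
  have bdd: "bdd_above (range (\<lambda>g. \<bar>f (t v g) - f g\<bar>))" for v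
  proof (rule bdd_aboveI2)
    show "\<bar>f (t v g) - f g\<bar> \<le> 2 * B" for g using B[of "t v g"] B[of g] by linarith
  qed
  assume L: ?L
  show ?R
  proof (intro allI impI)
    fix \<epsilon> :: real assume "\<epsilon> > 0"
    obtain V where V: "open V" "0 \<in> V" "\<forall>v\<in>V. (SUP g. \<bar>f (t v g) - f g\<bar>) < \<epsilon>"
      using L[rule_format, OF \<open>\<epsilon> > 0\<close>] by (elim exE conjE) (rule that)
    have "\<bar>f (t v g) - f g\<bar> < \<epsilon>" if "v \<in> V" for v g
      using cSUP_upper[OF UNIV_I bdd[of v]] V(3)[rule_format, OF that] by (rule le_less_trans)
    then show "\<exists>V. open V \<and> 0 \<in> V \<and> (\<forall>v\<in>V. \<forall>g. \<bar>f (t v g) - f g\<bar> < \<epsilon>)"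
      using V(1,2) by blast
  qed
next
  assume R: ?R
  show ?L
  proof (intro allI impI)
    fix \<epsilon> :: real assume "\<epsilon> > 0"
    \<comment> \<open>Half of \<open>\<epsilon>\<close>, since strict pointwise bounds give the
      supremum only a weak bound.\<close>
    then obtain V where V: "open V" "0 \<in> V" "\<forall>v\<in>V. \<forall>g. \<bar>f (t v g) - f g\<bar> < \<epsilon> / 2"
      using R[THEN spec, of "\<epsilon> / 2"] by auto
    have "(SUP g. \<bar>f (t v g) - f g\<bar>) < \<epsilon>" if "v \<in> V" for v
    proof -
      have "(SUP g. \<bar>f (t v g) - f g\<bar>) \<le> \<epsilon> / 2"
        using V(3) that by (intro cSUP_least) (auto intro: less_imp_le)
      then show ?thesis using \<open>\<epsilon> > 0\<close> by simp
    qed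
    then show "\<exists>V. open V \<and> 0 \<in> V \<and> (\<forall>v\<in>V. (SUP g. \<bar>f (t v g) - f g\<bar>) < \<epsilon>)"
      using V(1,2) by blast
  qed
qed

lemma RUC_iff:
  "f \<in> RUC \<longleftrightarrow> bounded (range f) \<and> continuous_on UNIV f \<and>
     (\<forall>\<epsilon>>0. \<exists>V. open V \<and> 0 \<in> V \<and> (\<forall>v\<in>V. \<forall>g. \<bar>f (v + g) - f g\<bar> < \<epsilon>))"
  unfolding RUC_def mem_Collect_eq
  by (intro conj_cong refl SUP_diff_less_iff[where t = "\<lambda>v g. v + g"])

lemma LUC_iff:
  "f \<in> LUC \<longleftrightarrow> bounded (range f) \<and> continuous_on UNIV f \<and>
     (\<forall>\<epsilon>>0. \<exists>V. open V \<and> 0 \<in> V \<and> (\<forall>v\<in>V. \<forall>g. \<bar>f (g + v) - f g\<bar> < \<epsilon>))"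
  unfolding LUC_def mem_Collect_eq
  by (intro conj_cong refl SUP_diff_less_iff[where t = "\<lambda>v g. g + v"])

section \<open>Functions coming from compactifications\<close>

lemma G_compactificationD:
  assumes "G_compactification Y act \<nu>"
  shows "completely_regular_space Y" "Hausdorff_space Y" "compact_space Y"
    "\<And>y. y \<in> topspace Y \<Longrightarrow> act 0 y = y"
    "\<And>g h y. y \<in> topspace Y \<Longrightarrow> act (g + h) y = act g (act h y)"
    "continuous_map (prod_topology euclidean Y) Y (\<lambda>(g, y). act g y)"
    "continuous_map euclidean Y \<nu>" "\<And>g x. \<nu> (g + x) = act g (\<nu> x)"
    "Y closure_of range \<nu> = topspace Y" "\<And>x. \<nu> x \<in> topspace Y"
  using assms continuous_map_image_subset_topspace[of euclidean Y \<nu>]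
  by (auto simp: G_compactification_def G_space_def)

text \<open>The function \<open>\<bar>F (act v y) - F y\<bar>\<close> is jointly continuous and
  vanishes at \<open>v = 0\<close>, hence is small for \<open>v\<close> near \<open>0\<close>
  uniformly in \<open>y\<close>; equivariance transfers this to \<open>y = \<nu> g\<close>.\<close>

lemma compactification_algebra_subset_RUC:
  assumes Y: "G_compactification Y act \<nu>"
  shows "compactification_algebra Y \<nu> \<subseteq> RUC"
proof
  fix f assume "f \<in> compactification_algebra Y \<nu>"
  then obtain F where F: "continuous_map Y euclideanreal F" and f: "f = F \<circ> \<nu>"
    by (auto simp: compactification_algebra_def)
  note c = G_compactificationD[OF Y]
  have "compactin euclideanreal (F ` topspace Y)"
    using c(3) F unfolding compact_space_def by (rule image_compactin)
  then have "bounded (F ` topspace Y)" by (simp add: compact_imp_bounded)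
  then have "bounded (range f)"
    by (rule bounded_subset) (use c(10) f in auto)
  moreover have "continuous_on UNIV f"
    using continuous_map_compose[OF c(7) F] f by simp
  moreover have "\<exists>V. open V \<and> 0 \<in> V \<and> (\<forall>v\<in>V. \<forall>g. \<bar>f (v + g) - f g\<bar> < \<epsilon>)" if \<epsilon>: "\<epsilon> > 0" for \<epsilon>
  proof -
    \<comment> \<open>The factors are swapped because \<open>uniform_near_zero\<close> expects the
      compact factor first.\<close>
    have "continuous_map (prod_topology Y euclidean) (prod_topology euclidean Y) (\<lambda>p. (snd p, fst p))"
      by (intro continuous_map_pairedI continuous_map_fst continuous_map_snd)
    from continuous_map_compose[OF this continuous_map_compose[OF c(6) F]]
    have "continuous_map (prod_topology Y euclidean) euclideanreal (\<lambda>p. F (act (snd p) (fst p)))"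
      by (simp add: comp_def case_prod_unfold)
    moreover have "continuous_map (prod_topology Y euclidean) euclideanreal (\<lambda>p. F (fst p))"
      using continuous_map_compose[OF continuous_map_fst F] by (simp add: comp_def)
    ultimately have "continuous_map (prod_topology Y euclidean) euclideanreal
        (\<lambda>p. \<bar>F (act (snd p) (fst p)) - F (fst p)\<bar>)"
      by (intro continuous_map_real_abs continuous_map_diff)
    then obtain V where "open V" "0 \<in> V"
      and V: "\<And>y v. y \<in> topspace Y \<Longrightarrow> v \<in> V \<Longrightarrow>
        \<bar>F (act (snd (y, v)) (fst (y, v))) - F (fst (y, v))\<bar> \<in> {..<\<epsilon>}"
      by (rule uniform_near_zero[OF c(3) _ open_openin[THEN iffD1, OF open_lessThan[of \<epsilon>]]]) (use \<epsilon> c(4) in auto)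
    moreover have "\<bar>f (v + g) - f g\<bar> < \<epsilon>" if "v \<in> V" for v g
      using V[OF c(10) that] by (simp add: f c(8))
    ultimately show ?thesis by blast
  qed
  ultimately show "f \<in> RUC" by (simp add: RUC_iff)
qed

lemma SUC_functions_subset_UC: "SUC_functions \<subseteq> (UC :: ('g::topological_group_add \<Rightarrow> real) set)"
proof
  fix f :: "'g \<Rightarrow> real" assume f: "f \<in> SUC_functions"
  then obtain Y :: "'g set set topology" and act \<nu> F where Y: "G_compactification Y act \<nu>"
    and S: "SUC_space Y act" and F: "continuous_map Y euclideanreal F" and eq: "f = F \<circ> \<nu>"
    by (auto simp: SUC_functions_def)
  note c = G_compactificationD[OF Y]
  have "f \<in> compactification_algebra Y \<nu>"
    using F eq by (auto simp: compactification_algebra_def)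
  then have R: "f \<in> RUC" using compactification_algebra_subset_RUC[OF Y] by blast
  have "\<exists>V. open V \<and> 0 \<in> V \<and> (\<forall>v\<in>V. \<forall>g. \<bar>f (g + v) - f g\<bar> < \<epsilon>)" if \<epsilon>: "\<epsilon> > 0" for \<epsilon>
  proof -
    \<comment> \<open>An open neighborhood of the diagonal, hence an entourage of \<open>Y\<close>.
      The SUC condition is used at \<open>\<nu> 0\<close>, whose orbit is
      \<open>range \<nu>\<close>.\<close>
    let ?W = "{p \<in> topspace (prod_topology Y Y). \<bar>F (fst p) - F (snd p)\<bar> \<in> {..<\<epsilon>}}"
    have "continuous_map (prod_topology Y Y) euclideanreal (\<lambda>p. \<bar>F (fst p) - F (snd p)\<bar>)"
      using continuous_map_compose[OF continuous_map_fst F] continuous_map_compose[OF continuous_map_snd F]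
      by (intro continuous_map_real_abs continuous_map_diff) (simp_all add: comp_def)
    then have "openin (prod_topology Y Y) ?W"
      by (rule openin_continuous_map_preimage) simp
    then have "eventually (\<lambda>p. p \<in> ?W) (the_uniformity Y)"
      unfolding eventually_the_uniformity[OF c(3,2)]
      using \<epsilon> by (intro exI[of _ ?W]) auto
    then obtain U where "open U" "0 \<in> U" "\<forall>g. \<forall>u\<in>U. (act (g + u) (\<nu> 0), act g (\<nu> 0)) \<in> ?W"
      using S c(10)[of 0] unfolding SUC_space_def by meson
    moreover have "act x (\<nu> 0) = \<nu> x" for x using c(8)[of x 0] by simp
    ultimately show ?thesis unfolding eq by (intro exI[of _ U]) auto
  qed
  then show "f \<in> UC" using R by (simp add: UC_def LUC_iff RUC_iff)
qed

section \<open>Basic properties of the induced right action\<close>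

context
  fixes S :: "'s topology" and act :: "'g::topological_group_add \<Rightarrow> 's \<Rightarrow> 's" and \<alpha> :: "'g \<Rightarrow> 's"
  assumes S: "G_compactification S act \<alpha>"
    and inv: "right_G_invariant (compactification_algebra S \<alpha>)"
begin

private abbreviation (input) "\<rho> \<equiv> induced_right_action S \<alpha>"

lemma right_action_in [simp]: "s \<in> topspace S \<Longrightarrow> \<rho> s g \<in> topspace S"
  by (rule induced_right_action[OF S inv])

text \<open>By right invariance the translate of \<open>F \<circ> \<alpha>\<close> is
  \<open>F' \<circ> \<alpha>\<close> with \<open>F'\<close> continuous. Evaluating the defining
  identity of the action as functionals gives \<open>F (\<rho> s g) = F' s\<close>.\<close>

lemma right_translate_extends:
  assumes F: "continuous_map S euclideanreal F"
  shows "continuous_map S euclideanreal (\<lambda>s. F (\<rho> s g))"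
    and "F (\<rho> (\<alpha> x) g) = F (\<alpha> (x + g))"
proof -
  note c = G_compactificationD[OF S]
  have A: "F \<circ> \<alpha> \<in> compactification_algebra S \<alpha>"
    using F by (auto simp: compactification_algebra_def)
  then have "(\<lambda>x. (F \<circ> \<alpha>) (x + g)) \<in> compactification_algebra S \<alpha>"
    using inv unfolding right_G_invariant_def by blast
  then obtain F' where F': "continuous_map S euclideanreal F'" "(\<lambda>x. (F \<circ> \<alpha>) (x + g)) = F' \<circ> \<alpha>"
    unfolding compactification_algebra_def by blast
  have eq: "F (\<rho> s g) = F' s" if "s \<in> topspace S" for s
    using induced_right_action(2)[OF S inv that A, of g]
    unfolding F'(2) gelfand_eval_eq[OF c(9) that F'(1)]
      gelfand_eval_eq[OF c(9) right_action_in[OF that] F] .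
  show "continuous_map S euclideanreal (\<lambda>s. F (\<rho> s g))"
    by (rule continuous_map_eq[OF F'(1)]) (simp add: eq)
  show "F (\<rho> (\<alpha> x) g) = F (\<alpha> (x + g))"
    using eq[OF c(10)] fun_cong[OF F'(2), of x] by simp
qed

text \<open>Complete regularity, applied to the complement of the closed set \<open>{t}\<close>,
  separates distinct points. Identities for the action can therefore be checked after applying each
  \<open>F\<close>.\<close>

lemma eq_if_continuous_functions_agree:
  assumes "s \<in> topspace S" "t \<in> topspace S" and "\<And>F. continuous_map S euclideanreal F \<Longrightarrow> F s = F t"
  shows "s = t"
proof (rule ccontr)
  assume "s \<noteq> t"
  note c = G_compactificationD[OF S]
  have "openin S (topspace S - {t})"
    using c(2) assms(2) by (simp add: Hausdorff_imp_t1_space closedin_t1_singleton openin_diff)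
  then obtain F where "continuous_map S euclideanreal F" "F s = 0" "F ` (topspace S - (topspace S - {t})) \<subseteq> {1}"
    using c(1) assms(1) \<open>s \<noteq> t\<close> unfolding completely_regular_space_alt' by (metis DiffI singletonD)
  moreover from this assms(2) have "F t = 1" by blast
  ultimately show False using assms(3)[of F] by simp
qed

lemma right_action_image: "\<rho> (\<alpha> x) g = \<alpha> (x + g)"
  using G_compactificationD(10)[OF S] right_translate_extends(2)
  by (intro eq_if_continuous_functions_agree) auto

lemma right_action_0: "s \<in> topspace S \<Longrightarrow> \<rho> s 0 = s"
proof (rule eq_if_continuous_functions_agree)
  note c = G_compactificationD[OF S]
  fix F assume s: "s \<in> topspace S" and F: "continuous_map S euclideanreal F"
  show "F (\<rho> s 0) = F s"
  proof (rule forall_in_closure_of_eq[OF _ _ right_translate_extends(1)[OF F] F])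
    show "s \<in> S closure_of range \<alpha>" using c(9) s by simp
  qed (auto simp: right_action_image)
qed auto

section \<open>Left uniform continuity and joint continuity\<close>

lemma UC_if_right_action_continuous:
  assumes \<rho>: "continuous_map (prod_topology S euclidean) S (\<lambda>(s, g). \<rho> s g)"
  shows "compactification_algebra S \<alpha> \<subseteq> UC"
proof
  note c = G_compactificationD[OF S]
  fix f assume f: "f \<in> compactification_algebra S \<alpha>"
  then obtain F where F: "continuous_map S euclideanreal F" and eq: "f = F \<circ> \<alpha>"
    by (auto simp: compactification_algebra_def)
  have R: "f \<in> RUC" using f compactification_algebra_subset_RUC[OF S] by blast
  have "\<exists>V. open V \<and> 0 \<in> V \<and> (\<forall>v\<in>V. \<forall>g. \<bar>f (g + v) - f g\<bar> < \<epsilon>)" if \<epsilon>: "\<epsilon> > 0" for \<epsilon>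
  proof -
    have "continuous_map (prod_topology S euclidean) euclideanreal
        (\<lambda>p. \<bar>F (\<rho> (fst p) (snd p)) - F (fst p)\<bar>)"
      using continuous_map_compose[OF \<rho> F] continuous_map_compose[OF continuous_map_fst F]
      by (intro continuous_map_real_abs continuous_map_diff) (simp_all add: comp_def case_prod_unfold)
    then obtain V where "open V" "0 \<in> V"
      and V: "\<And>s v. s \<in> topspace S \<Longrightarrow> v \<in> V \<Longrightarrow>
        \<bar>F (\<rho> (fst (s, v)) (snd (s, v))) - F (fst (s, v))\<bar> \<in> {..<\<epsilon>}"
      by (rule uniform_near_zero[OF c(3) _ open_openin[THEN iffD1, OF open_lessThan[of \<epsilon>]]]) (use \<epsilon> right_action_0 in auto)
    moreover have "\<bar>f (g + v) - f g\<bar> < \<epsilon>" if "v \<in> V" for v g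
      using V[OF c(10) that] by (simp add: eq right_action_image)
    ultimately show ?thesis by blast
  qed
  then show "f \<in> UC" using R by (simp add: UC_def LUC_iff RUC_iff)
qed

text \<open>With both terms controlled by \<open>\<epsilon> / 2\<close>, the distance from
  \<open>F (\<rho> t h)\<close> to \<open>F (\<rho> s g)\<close> is split at
  \<open>F (\<rho> t g)\<close>: the first part is small uniformly in \<open>t\<close> for
  \<open>h\<close> near \<open>g\<close>, the second for \<open>t\<close> near
  \<open>s\<close>.\<close>

lemma right_action_continuous_if_UC:
  assumes UC: "compactification_algebra S \<alpha> \<subseteq> UC"
  shows "continuous_map (prod_topology S euclidean) S (\<lambda>(s, g). \<rho> s g)"
proof (rule continuous_map_into_completely_regular)
  note c = G_compactificationD[OF S]
  show "completely_regular_space S" by (rule c(1))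
  show "(\<lambda>(s, g). \<rho> s g) ` topspace (prod_topology S euclidean) \<subseteq> topspace S" by auto
  fix F assume F: "continuous_map S euclideanreal F"
  have "\<exists>U. openin (prod_topology S euclidean) U \<and> (s, g) \<in> U \<and>
      (\<forall>p\<in>U. F (\<rho> (fst p) (snd p)) \<in> ball (F (\<rho> s g)) \<epsilon>)"
    if s: "s \<in> topspace S" and "\<epsilon> > 0" for s g \<epsilon>
  proof -
    have "F \<circ> \<alpha> \<in> compactification_algebra S \<alpha>"
      using F by (auto simp: compactification_algebra_def)
    \<comment> \<open>Left uniform continuity of the translate by \<open>g\<close> inserts
      \<open>v\<close> between \<open>x\<close> and \<open>g\<close>, which yields control near an
      arbitrary \<open>g\<close> and not only near \<open>0\<close>.\<close>
    then have "(\<lambda>x. (F \<circ> \<alpha>) (x + g)) \<in> LUC"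
      using inv UC unfolding right_G_invariant_def UC_def by blast
    then obtain V where V: "open V" "0 \<in> V"
        "\<And>v x. v \<in> V \<Longrightarrow> \<bar>F (\<alpha> (x + v + g)) - F (\<alpha> (x + g))\<bar> < \<epsilon> / 2"
      using \<open>\<epsilon> > 0\<close> unfolding LUC_iff comp_def by (meson half_gt_zero)
    \<comment> \<open>On \<open>range \<alpha>\<close> this is the choice of \<open>V\<close>. The
      bound is weakened to \<le> so that it defines a closed set and passes to the closure.\<close>
    have near: "\<bar>F (\<rho> t (v + g)) - F (\<rho> t g)\<bar> \<le> \<epsilon> / 2" if v: "v \<in> V" and t: "t \<in> topspace S" for t v
    proof (rule forall_in_closure_of[of t S "range \<alpha>"])
      show "t \<in> S closure_of range \<alpha>" using c(9) t by simp
      show "\<bar>F (\<rho> y (v + g)) - F (\<rho> y g)\<bar> \<le> \<epsilon> / 2" if "y \<in> range \<alpha>" for y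
        using that V(3)[OF v] by (auto simp: right_action_image add.assoc intro: less_imp_le)
      have "continuous_map S euclideanreal (\<lambda>t. \<bar>F (\<rho> t (v + g)) - F (\<rho> t g)\<bar>)"
        by (intro continuous_map_real_abs continuous_map_diff right_translate_extends F)
      from closedin_continuous_map_preimage[OF this, of "{..\<epsilon>/2}"]
      show "closedin S {t \<in> topspace S. \<bar>F (\<rho> t (v + g)) - F (\<rho> t g)\<bar> \<le> \<epsilon> / 2}" by simp
    qed
    define A where "A = {t \<in> topspace S. F (\<rho> t g) \<in> ball (F (\<rho> s g)) (\<epsilon> / 2)}"
    have A: "openin S A"
      unfolding A_def by (rule openin_continuous_map_preimage[OF right_translate_extends(1)[OF F]]) simp
    \<comment> \<open>The right translate of \<open>V\<close> by \<open>g\<close>: each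
      \<open>h\<close> in \<open>B\<close> is \<open>v + g\<close> with \<open>v = h + - g\<close>
      in \<open>V\<close>.\<close>
    define B where "B = (\<lambda>h. h + - g) -` V"
    have "continuous_on UNIV (\<lambda>h. h + - g)"
      unfolding continuous_on_def by (intro ballI tendsto_add tendsto_ident_at tendsto_const)
    then have B: "open B"
      unfolding B_def using V(1) by (rule open_vimage[rotated])
    have "F (\<rho> t h) \<in> ball (F (\<rho> s g)) \<epsilon>" if "t \<in> A" "h \<in> B" for t h
    proof -
      have "\<bar>F (\<rho> t h) - F (\<rho> t g)\<bar> \<le> \<epsilon> / 2"
        using near[of "h + - g" t] that by (simp add: A_def B_def add.assoc)
      moreover have "\<bar>F (\<rho> s g) - F (\<rho> t g)\<bar> < \<epsilon> / 2" using that by (simp add: A_def dist_real_def)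
      ultimately show ?thesis unfolding mem_ball dist_real_def by linarith
    qed
    moreover have "(s, g) \<in> A \<times> B" using s V(2) \<open>\<epsilon> > 0\<close> by (simp add: A_def B_def)
    ultimately show ?thesis
      using A B by (intro exI[of _ "A \<times> B"]) (auto simp: openin_prod_Times_iff)
  qed
  then show "continuous_map (prod_topology S euclidean) euclideanreal (F \<circ> (\<lambda>(s, g). \<rho> s g))"
    unfolding Met_TC.continuous_map_to_metric[where ?'a = real, simplified]
    by (auto simp: case_prod_unfold)
qed

section \<open>The SUC property of semigroup compactifications\<close>

lemma SUC_space_if_right_action_continuous:
  assumes \<rho>: "continuous_map (prod_topology S euclidean) S (\<lambda>(s, g). \<rho> s g)"
    and mul: "right_topological_semigroup_compactification S act \<alpha> mul"
  shows "SUC_space S act"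
  unfolding SUC_space_def
proof (intro conjI ballI allI impI)
  note c = G_compactificationD[OF S]
  show "G_space S act" using S by (simp add: G_compactification_def)
  show "compact_space S" by (rule c(3))
  fix p E assume p: "p \<in> topspace S" and "eventually E (the_uniformity S)"
  then obtain W where W: "openin (prod_topology S S) W" "\<And>y. y \<in> topspace S \<Longrightarrow> (y, y) \<in> W"
      "\<And>q. q \<in> W \<Longrightarrow> E q"
    unfolding eventually_the_uniformity[OF c(3,2)] by blast
  have cp: "continuous_map S S (\<lambda>s. mul s p)"
    and act: "\<And>g. act g p = mul (\<alpha> g) p"
    and pS: "\<And>s. s \<in> topspace S \<Longrightarrow> mul s p \<in> topspace S"
    using mul p by (auto simp: right_topological_semigroup_compactification_def right_topological_semigroup_def)
  have "continuous_map (prod_topology S euclidean) (prod_topology S S)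
      (\<lambda>q. (mul (\<rho> (fst q) (snd q)) p, mul (fst q) p))"
    using continuous_map_compose[OF \<rho> cp] continuous_map_compose[OF continuous_map_fst cp]
    by (intro continuous_map_pairedI) (simp_all add: comp_def case_prod_unfold)
  then obtain U where U: "open U" "0 \<in> U" "\<And>s u. s \<in> topspace S \<Longrightarrow> u \<in> U \<Longrightarrow>
      (mul (\<rho> (fst (s, u)) (snd (s, u))) p, mul (fst (s, u)) p) \<in> W"
    by (rule uniform_near_zero[OF c(3) _ W(1)]) (use W(2) pS in \<open>auto simp: right_action_0\<close>)
  have "E (act (g + u) p, act g p)" if "u \<in> U" for g u
    \<comment> \<open>The uniform statement is specialized to \<open>s = \<alpha> g\<close>, where
      \<open>\<rho> (\<alpha> g) u = \<alpha> (g + u)\<close> and left multiplication by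
      \<open>\<alpha> g\<close> is the action of \<open>g\<close>.\<close>
    using U(3)[OF c(10) that, of g] by (intro W(3)) (simp add: act right_action_image)
  then show "\<exists>U. open U \<and> 0 \<in> U \<and> (\<forall>g. \<forall>u\<in>U. E (act (g + u) p, act g p))" using U by blast
qed

end


theorem theorem4p9:
  fixes S :: "'s topology"
    and act :: "'g::topological_group_add \<Rightarrow> 's \<Rightarrow> 's"
    and \<alpha> :: "'g \<Rightarrow> 's"
  assumes "G_compactification S act \<alpha>"
    and "right_G_invariant (compactification_algebra S \<alpha>)"
  shows "((compactification_algebra S \<alpha> \<subseteq> UC \<longleftrightarrow>
             continuous_map (prod_topology S euclidean) S (\<lambda>(s, g). induced_right_action S \<alpha> s g)) \<and>
          (compactification_algebra S \<alpha> \<subseteq> SUC_functions \<longrightarrow> compactification_algebra S \<alpha> \<subseteq> UC)) \<and>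
         (\<forall>mul. right_topological_semigroup_compactification S act \<alpha> mul \<longrightarrow>
            (compactification_algebra S \<alpha> \<subseteq> UC \<longleftrightarrow>
               continuous_map (prod_topology S euclidean) S (\<lambda>(s, g). induced_right_action S \<alpha> s g)) \<and>
            (continuous_map (prod_topology S euclidean) S (\<lambda>(s, g). induced_right_action S \<alpha> s g) \<longleftrightarrow>
               compactification_algebra S \<alpha> \<subseteq> SUC_functions))"
proof (intro conjI allI impI)
  note S = assms
  let ?A = "compactification_algebra S \<alpha>"
  let ?c = "continuous_map (prod_topology S euclidean) S (\<lambda>(s, g). induced_right_action S \<alpha> s g)"
  show iff: "?A \<subseteq> UC \<longleftrightarrow> ?c"
    using right_action_continuous_if_UC[OF S] UC_if_right_action_continuous[OF S] by blast
  show "?A \<subseteq> UC \<longleftrightarrow> ?c" by (rule iff)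
  show SUC: "?A \<subseteq> UC" if "?A \<subseteq> SUC_functions"
    using that SUC_functions_subset_UC by blast
  show "?c \<longleftrightarrow> ?A \<subseteq> SUC_functions"
    if mul: "right_topological_semigroup_compactification S act \<alpha> mul" for mul
  proof
    assume ?c
    then have "SUC_space S act" using mul by (rule SUC_space_if_right_action_continuous[OF S])
    \<comment> \<open>\<open>S\<close> itself is the SUC compactification;
      \<open>SUC_functionsI\<close> moves it to the prescribed carrier type.\<close>
    then show "?A \<subseteq> SUC_functions"
      using SUC_functionsI[OF S(1)] by (auto simp: compactification_algebra_def)
  next
    assume "?A \<subseteq> SUC_functions"
    then show ?c using SUC iff by blast
  qed
qed

end
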